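(* Let $a<b$ be real numbers, let $r,s$ be positive continuous functions on the interval $(a,b)$, and let $p>1$ and $q$ be real numbers with $\frac1p+\frac1q=1$. Put $R(x,b)=\int_x^b r(t)\,dt$. Then for all measurable functions $f\ge 0$ on $(a,b)$ such that all integrals below exist and are finite, $$\int_a^b r(x)\left(\int_a^x f(t)\,dt\right)^2dx\le \sup_{a<x<b}R(x,b)\,\left(\int_a^b\left(\frac1{s(x)}\right)^{p-1}dx\right)^{\frac2p}\left(\int_a^b s(x)\,(f(x))^q\,dx\right)^{\frac2q}.$$
   Context: Standing assumption: all functions are measurable and all the integrals appearing in the inequality (including those defining $R(x,b)$ and $\int_a^x f$ for $x\in(a,b)$) exist and are finite. The supremum is taken in $[0,+\infty]$, with $0\cdot\infty=0$. *)

theory Defs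
  imports "HOL-Analysis.Analysis"
begin

definition R :: "(real \<Rightarrow> real) \<Rightarrow> real \<Rightarrow> real \<Rightarrow> real"
  where "R r x b = (LINT t:{x<..<b}|lebesgue. r t)"

end

theory Submission
  imports Defs "HOL-Real_Asymp.Real_Asymp"
begin

text \<open>
  Write \<open>F x\<close> for the integral of \<open>f\<close> over \<open>(a, x)\<close>. Hoelder's inequality applied to
  \<open>f = s\<^sup>-\<^sup>1\<^sup>/\<^sup>q \<cdot> (s\<^sup>1\<^sup>/\<^sup>q f)\<close> bounds \<open>F\<close> pointwise by a constant \<open>K\<close>
  whose square is the product of the last two factors. Hence the integral of \<open>r F\<^sup>2\<close> over
  \<open>(x, b)\<close> is at most \<open>K\<^sup>2 R(x, b)\<close> for every \<open>x\<close>, and \<open>x\<close> tends to \<open>a\<close>.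
\<close>

lemma set_integral_nonneg:
  fixes g :: "'a \<Rightarrow> real"
  assumes "\<And>x. x \<in> S \<Longrightarrow> g x \<ge> 0"
  shows "(LINT x:S|M. g x) \<ge> 0"
  using assms unfolding set_lebesgue_integral_def
  by (intro Bochner_Integration.integral_nonneg) (auto simp: indicator_def)

lemma set_integral_mono_subset:
  fixes g :: "'a \<Rightarrow> real"
  assumes "set_integrable M T g" "S \<in> sets M" "S \<subseteq> T" "\<And>x. x \<in> T \<Longrightarrow> g x \<ge> 0"
  shows "(LINT x:S|M. g x) \<le> (LINT x:T|M. g x)"
  using set_integrable_subset[OF assms(1-3)] assms
  unfolding set_lebesgue_integral_def set_integrable_def
  by (intro integral_mono) (auto simp: indicator_def)

text \<open>Young's inequality for the normalised functions \<open>u x / \<alpha>\<close> and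
  \<open>v x / \<beta>\<close>, integrated over \<open>S\<close>. Normalising by the exact norms
  would fail when one of them vanishes, so both integrals are first enlarged by
  \<open>e > 0\<close>, and then \<open>e\<close> tends to 0.\<close>

lemma set_integral_Holder:
  fixes u v :: "'a \<Rightarrow> real" and p q :: real
  assumes pq: "p > 1" "q > 1" "1 / p + 1 / q = 1"
    and nn: "\<And>x. x \<in> S \<Longrightarrow> u x \<ge> 0" "\<And>x. x \<in> S \<Longrightarrow> v x \<ge> 0"
    and iuv: "set_integrable M S (\<lambda>x. u x * v x)"
    and iu: "set_integrable M S (\<lambda>x. u x powr p)"
    and iv: "set_integrable M S (\<lambda>x. v x powr q)"
  shows "(LINT x:S|M. u x * v x)
    \<le> (LINT x:S|M. u x powr p) powr (1 / p) * (LINT x:S|M. v x powr q) powr (1 / q)"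
proof -
  define A B where "A = (LINT x:S|M. u x powr p)" and "B = (LINT x:S|M. v x powr q)"
  have AB: "A \<ge> 0" "B \<ge> 0"
    unfolding A_def B_def by (simp_all add: set_integral_nonneg)
  have le: "(LINT x:S|M. u x * v x) \<le> (A + e) powr (1 / p) * (B + e) powr (1 / q)" if "e > 0" for e
  proof -
    define \<alpha> \<beta> where "\<alpha> = (A + e) powr (1 / p)" and "\<beta> = (B + e) powr (1 / q)"
    have pos: "\<alpha> > 0" "\<beta> > 0" and pw: "\<alpha> powr p = A + e" "\<beta> powr q = B + e"
      using AB that pq by (auto simp: \<alpha>_def \<beta>_def powr_powr)
    \<comment> \<open>The coefficients are those of Young's inequality after multiplying back by
      \<open>\<alpha> * \<beta>\<close>; they are constants, so the right side integrates to a
      combination of \<open>A\<close> and \<open>B\<close>.\<close>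
    have "u x * v x \<le> \<alpha> * \<beta> / (p * (A + e)) * u x powr p + \<alpha> * \<beta> / (q * (B + e)) * v x powr q"
      if "x \<in> S" for x
    proof -
      have "u x / \<alpha> * (v x / \<beta>) \<le> (u x / \<alpha>) powr p / p + (v x / \<beta>) powr q / q"
        using pq nn[OF that] pos by (intro Youngs_inequality) auto
      also have "\<dots> = u x powr p / (A + e) / p + v x powr q / (B + e) / q"
        using nn[OF that] pos by (simp add: powr_divide pw)
      finally have "\<alpha> * \<beta> * (u x / \<alpha> * (v x / \<beta>)) 
          \<le> \<alpha> * \<beta> * (u x powr p / (A + e) / p + v x powr q / (B + e) / q)"
        using pos by (intro mult_left_mono) auto
      moreover have "\<alpha> * \<beta> * (u x / \<alpha> * (v x / \<beta>)) = u x * v x"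
        using pos by simp
      ultimately show ?thesis
        by (simp add: algebra_simps)
    qed
    then have "(LINT x:S|M. u x * v x)
        \<le> (LINT x:S|M. \<alpha> * \<beta> / (p * (A + e)) * u x powr p + \<alpha> * \<beta> / (q * (B + e)) * v x powr q)"
      by (intro set_integral_mono iuv set_integral_add set_integrable_mult_right iu iv)
    also have "\<dots> = \<alpha> * \<beta> / (p * (A + e)) * A + \<alpha> * \<beta> / (q * (B + e)) * B"
      unfolding A_def B_def
      by (subst set_integral_add(2)) (intro set_integrable_mult_right iu iv | simp)+
    also have "\<dots> = \<alpha> * \<beta> * (1 / p * (A / (A + e)) + 1 / q * (B / (B + e)))"
      by (simp add: distrib_left)
    \<comment> \<open>Both quotients are at most 1, and the weights \<open>1 / p\<close> and
      \<open>1 / q\<close> sum to 1, so only \<open>\<alpha> * \<beta>\<close> remains.\<close>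
    also have "\<dots> \<le> \<alpha> * \<beta> * (1 / p * 1 + 1 / q * 1)"
      using AB \<open>e > 0\<close> pos pq by (intro mult_left_mono add_mono) auto
    finally show ?thesis
      using pq by (simp add: \<alpha>_def \<beta>_def)
  qed
  \<comment> \<open>The exponents are positive, so \<open>powr\<close> is continuous from the right
    even at base 0; this covers \<open>A = 0\<close> and \<open>B = 0\<close>.\<close>
  have "((\<lambda>e. (A + e) powr (1 / p) * (B + e) powr (1 / q))
      \<longlongrightarrow> (A + 0) powr (1 / p) * (B + 0) powr (1 / q)) (at_right 0)"
    using AB pq by (intro tendsto_intros tendsto_powr2) (auto simp: eventually_at_filter)
  moreover have "eventually (\<lambda>e. (LINT x:S|M. u x * v x)
      \<le> (A + e) powr (1 / p) * (B + e) powr (1 / q)) (at_right 0)"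
    using le by (auto simp: eventually_at_filter)
  ultimately show ?thesis
    unfolding A_def[symmetric] B_def[symmetric]
    using tendsto_lowerbound by fastforce
qed

theorem theorem2p7:
  fixes a b p q :: real and r s f :: "real \<Rightarrow> real"
  assumes "a < b"
    and "continuous_on {a<..<b} r" and "\<And>x. x \<in> {a<..<b} \<Longrightarrow> r x > 0"
    and "continuous_on {a<..<b} s" and "\<And>x. x \<in> {a<..<b} \<Longrightarrow> s x > 0"
    and "p > 1" and "1 / p + 1 / q = 1"
    and "set_borel_measurable lebesgue {a<..<b} f"
    and "\<And>x. x \<in> {a<..<b} \<Longrightarrow> f x \<ge> 0"
    and "\<And>x. x \<in> {a<..<b} \<Longrightarrow> set_integrable lebesgue {x<..<b} r"
    and "\<And>x. x \<in> {a<..<b} \<Longrightarrow> set_integrable lebesgue {a<..<x} f"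
    and "set_integrable lebesgue {a<..<b} (\<lambda>x. r x * (LINT t:{a<..<x}|lebesgue. f t)\<^sup>2)"
    and "set_integrable lebesgue {a<..<b} (\<lambda>x. (1 / s x) powr (p - 1))"
    and "set_integrable lebesgue {a<..<b} (\<lambda>x. s x * f x powr q)"
  shows "ereal (LINT x:{a<..<b}|lebesgue. r x * (LINT t:{a<..<x}|lebesgue. f t)\<^sup>2)
    \<le> (SUP x\<in>{a<..<b}. ereal (R r x b))
        * ereal ((LINT x:{a<..<b}|lebesgue. (1 / s x) powr (p - 1)) powr (2 / p))
        * ereal ((LINT x:{a<..<b}|lebesgue. s x * f x powr q) powr (2 / q))"
proof -
  note r = assms(3) and s = assms(5) and f = assms(9)
  define F where "F x = (LINT t:{a<..<x}|lebesgue. f t)" for x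
  define A B where "A = (LINT x:{a<..<b}|lebesgue. (1 / s x) powr (p - 1))"
    and "B = (LINT x:{a<..<b}|lebesgue. s x * f x powr q)"
  define K where "K = A powr (1 / p) * B powr (1 / q)"
  \<comment> \<open>With total division, \<open>q = 0\<close> would give \<open>1 / q = 0\<close>
    and hence \<open>p = 1\<close>; taking inverses of both sides therefore needs no case
    split.\<close>
  have q: "q = p / (p - 1)" "q > 1"
  proof -
    have "1 / q = (p - 1) / p"
      using assms(6,7) by (simp add: field_simps)
    then have "inverse (1 / q) = inverse ((p - 1) / p)" by simp
    then show "q = p / (p - 1)" by simp
    with assms(6) show "q > 1" by simp
  qed
  have F: "0 \<le> F x" "F x \<le> K" if x: "x \<in> {a<..<b}" for x
  proof -
    have sub: "{a<..<x} \<subseteq> {a<..<b}" using x by auto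
    note iA = set_integrable_subset[OF assms(13) _ sub] and iB = set_integrable_subset[OF assms(14) _ sub]
    \<comment> \<open>The weight \<open>s\<close> is split so that it cancels in
      \<open>u t * v t\<close>. Since \<open>p / q = p - 1\<close>, the powers of \<open>u\<close>
      and \<open>v\<close> are exactly the integrands of \<open>A\<close> and
      \<open>B\<close>.\<close>
    define u v where "u = (\<lambda>t. (1 / s t) powr (1 / q))" and "v = (\<lambda>t. s t powr (1 / q) * f t)"
    have uv: "u t * v t = f t" "u t powr p = (1 / s t) powr (p - 1)" "v t powr q = s t * f t powr q"
      if "t \<in> {a<..<x}" for t
    proof -
      have st: "s t > 0" "f t \<ge> 0" using s f sub that by auto
      then show "u t * v t = f t" by (simp add: u_def v_def powr_divide)
      have "p / q = p - 1" using q assms(6) by simp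
      then show "u t powr p = (1 / s t) powr (p - 1)"
        by (simp add: u_def powr_powr)
      show "v t powr q = s t * f t powr q"
        using st q(2) by (simp add: v_def powr_mult powr_powr)
    qed
    have cong: "set_integrable lebesgue {a<..<x} h"
      if "set_integrable lebesgue {a<..<x} g" "\<And>t. t \<in> {a<..<x} \<Longrightarrow> h t = g t" for g h :: "real \<Rightarrow> real"
      by (rule iffD2[OF set_integrable_cong[OF refl refl that(2)] that(1)])
    have *: "set_integrable lebesgue {a<..<x} (\<lambda>t. u t * v t)"
      "set_integrable lebesgue {a<..<x} (\<lambda>t. u t powr p)"
      "set_integrable lebesgue {a<..<x} (\<lambda>t. v t powr q)"
      by (rule cong[OF assms(11)[OF x] uv(1)] cong[OF iA uv(2)] cong[OF iB uv(3)]; simp)+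
    have "F x = (LINT t:{a<..<x}|lebesgue. u t * v t)"
      unfolding F_def by (rule set_lebesgue_integral_cong) (auto simp: uv)
    also have "\<dots> \<le> (LINT t:{a<..<x}|lebesgue. u t powr p) powr (1 / p)
        * (LINT t:{a<..<x}|lebesgue. v t powr q) powr (1 / q)"
      using assms(6,7) q * f sub
      by (intro set_integral_Holder) (auto simp: u_def v_def)
    \<comment> \<open>Both integrands are nonnegative, so enlarging the domain to
      \<open>{a<..<b}\<close> only increases the factors and makes the bound independent of
      \<open>x\<close>.\<close>
    also have "\<dots> \<le> K"
    proof -
      have "(LINT t:{a<..<x}|lebesgue. u t powr p) = (LINT t:{a<..<x}|lebesgue. (1 / s t) powr (p - 1))"
        by (rule set_lebesgue_integral_cong) (auto simp: uv)
      also have "\<dots> \<le> A"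
        unfolding A_def using assms(13) sub by (intro set_integral_mono_subset) auto
      finally have 1: "(LINT t:{a<..<x}|lebesgue. u t powr p) \<le> A" .
      have "(LINT t:{a<..<x}|lebesgue. v t powr q) = (LINT t:{a<..<x}|lebesgue. s t * f t powr q)"
        by (rule set_lebesgue_integral_cong) (auto simp: uv)
      also have "\<dots> \<le> B"
        unfolding B_def using assms(14) sub s
        by (intro set_integral_mono_subset) (auto simp: less_imp_le)
      finally have 2: "(LINT t:{a<..<x}|lebesgue. v t powr q) \<le> B" .
      show ?thesis
        unfolding K_def using 1 2 assms(6) q
        by (intro mult_mono powr_mono2) (auto intro!: set_integral_nonneg)
    qed
    finally show "F x \<le> K" .
    show "0 \<le> F x"
      unfolding F_def using f sub by (intro set_integral_nonneg) auto
  qed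
  define P Q where "P = A powr (2 / p)" and "Q = B powr (2 / q)"
  have K2: "K\<^sup>2 = P * Q"
  proof -
    have "(y powr (1 / u))\<^sup>2 = y powr (2 / u)" for y u :: real
      using powr_add[of y "1 / u" "1 / u"] by (simp add: power2_eq_square)
    then show ?thesis
      by (simp only: K_def P_def Q_def power_mult_distrib)
  qed
  let ?S = "SUP x\<in>{a<..<b}. ereal (R r x b)"
  \<comment> \<open>The integral is cut off at \<open>x > a\<close> because \<open>r\<close> is
    integrable only on such intervals: near \<open>a\<close> its integral may diverge, and then
    \<open>?S\<close> is infinite.\<close>
  have le: "ereal (LINT t:{x<..<b}|lebesgue. r t * (F t)\<^sup>2) \<le> ?S * ereal P * ereal Q"
    if x: "x \<in> {a<..<b}" for x
  proof -
    have "(LINT t:{x<..<b}|lebesgue. r t * (F t)\<^sup>2) \<le> (LINT t:{x<..<b}|lebesgue. r t * K\<^sup>2)"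
    proof (intro set_integral_mono set_integrable_mult_left)
      show "set_integrable lebesgue {x<..<b} (\<lambda>t. r t * (F t)\<^sup>2)"
        unfolding F_def by (rule set_integrable_subset[OF assms(12)]) (use x in auto)
      show "set_integrable lebesgue {x<..<b} r" by (rule assms(10)[OF x])
      show "r t * (F t)\<^sup>2 \<le> r t * K\<^sup>2" if "t \<in> {x<..<b}" for t
        using F[of t] r[of t] that x by (intro mult_left_mono power_mono) (auto simp: less_imp_le)
    qed
    then have "ereal (LINT t:{x<..<b}|lebesgue. r t * (F t)\<^sup>2) \<le> ereal (R r x b) * ereal P * ereal Q"
      by (simp add: R_def K2 mult.assoc)
    \<comment> \<open>Multiplying by the nonnegative \<open>P\<close> and \<open>Q\<close> is
      monotone in \<open>ereal\<close> even if \<open>?S\<close> is infinite and a factor is 0, as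
      that product is then 0.\<close>
    also have "\<dots> \<le> ?S * ereal P * ereal Q"
      using x by (intro ereal_mult_right_mono SUP_upper) (auto simp: P_def Q_def)
    finally show ?thesis .
  qed
  \<comment> \<open>The shift by 2 keeps \<open>c 0\<close> strictly below \<open>b\<close>; a shift
    by 1 would give \<open>c 0 = b\<close>.\<close>
  define c where "c n = a + (b - a) / real (n + 2)" for n
  have c: "c n \<in> {a<..<b}" for n
  proof -
    have "(b - a) / real (n + 2) < (b - a) / 1"
      using assms(1) by (intro divide_strict_left_mono) auto
    with assms(1) show ?thesis by (simp add: c_def)
  qed
  have "decseq c"
    unfolding c_def using assms(1) by (auto simp: decseq_def intro!: divide_left_mono)
  then have inc: "incseq (\<lambda>n. {c n<..<b})"
    unfolding incseq_def decseq_def by (meson greaterThanLessThan_subseteq_greaterThanLessThan order_refl)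
  have lim: "c \<longlonglongrightarrow> a"
    unfolding c_def by real_asymp
  have un: "(\<Union>n. {c n<..<b}) = {a<..<b}"
  proof (intro set_eqI iffI)
    fix x assume x: "x \<in> {a<..<b}"
    with lim have "eventually (\<lambda>n. c n < x) sequentially"
      by (intro order_tendstoD(2)) auto
    then obtain n where "c n < x"
      using eventually_happens' sequentially_bot by blast
    with x show "x \<in> (\<Union>n. {c n<..<b})" by auto
  next
    fix x assume "x \<in> (\<Union>n. {c n<..<b})"
    then obtain n where "c n < x" "x < b" by auto
    with c[of n] show "x \<in> {a<..<b}" by simp
  qed
  \<comment> \<open>The integral is continuous along increasing sets because the integrand is
    integrable on their union. The bound \<open>le\<close> does not depend on \<open>n\<close>, so
    it survives the limit.\<close>
  have "(\<lambda>n. LINT t:{c n<..<b}|lebesgue. r t * (F t)\<^sup>2)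
      \<longlonglongrightarrow> (LINT t:(\<Union>n. {c n<..<b})|lebesgue. r t * (F t)\<^sup>2)"
    using inc assms(12) by (intro set_integral_cont_up) (auto simp: un F_def)
  then have "ereal (LINT t:{a<..<b}|lebesgue. r t * (F t)\<^sup>2) \<le> ?S * ereal P * ereal Q"
    unfolding un using le[OF c] by (intro LIMSEQ_le_const2[OF tendsto_ereal]) blast+
  then show ?thesis
    by (simp only: F_def P_def Q_def A_def B_def)
qed

end
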